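(* Let $\mathcal{H}$ be a real Hilbert space and let $T:\mathcal{H}\rightrightarrows\mathcal{H}$ be maximal monotone with $T^{-1}(0)\neq\emptyset$. Let $\{z^k\}$ and $\{\bar z^k\}$ be sequences generated by the Halpern accelerated inexact proximal point algorithm under criterion (A) (both described in the context), with the parameters $c_k>0$ bounded away from zero. Then $\{z^k\}$ converges in the weak topology to a point $z^\infty$ satisfying $0\in T(z^\infty)$, and $$\lim_{k\to\infty}\|Q_{c_k}(z^k)\|=0,\qquad \lim_{k\to\infty}\|\bar z^k-z^k\|=0 .$$
   Context: For $c>0$, $P_c=(I+cT)^{-1}$ is the (single-valued, everywhere defined) proximal mapping of $T$, and $Q_c=I-P_c$. $T^{-1}(0)=\{z\in\mathcal{H}:0\in T(z)\}$. Halpern accelerated inexact proximal point algorithm: choose $z^0\in\mathcal{H}$ and a sequence of parameters $c_k>0$; for $k=0,1,2,\ldots$ compute $\bar z^k\approx P_{c_k}(z^k)$ according to an inexactness criterion, and set $$z^{k+1}=\frac{1}{k+2}z^0+\frac{k+1}{k+2}\bar z^k .$$ Criterion (A): $\|\bar z^k-P_{c_k}(z^k)\|\le\varepsilon_k$ for all $k\ge 0$, where $\varepsilon_k\ge 0$ and $\sum_{k=0}^\infty\varepsilon_k<+\infty$. *)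

theory Defs
  imports "HOL-Analysis.Analysis"
begin

text \<open>Set-valued operators are functions into sets; a value may be empty.\<close>

type_synonym 'a operator = "'a \<Rightarrow> 'a set"

definition monotone_operator :: "'a::real_inner operator \<Rightarrow> bool" where
  "monotone_operator T \<longleftrightarrow>
     (\<forall>x y. \<forall>u\<in>T x. \<forall>v\<in>T y. (x - y) \<bullet> (u - v) \<ge> 0)"

text \<open>The pointwise order \<open>T \<le> S\<close> is inclusion of graphs.\<close>

definition maximal_monotone :: "'a::real_inner operator \<Rightarrow> bool" where
  "maximal_monotone T \<longleftrightarrow>
     monotone_operator T \<and> (\<forall>S. monotone_operator S \<longrightarrow> T \<le> S \<longrightarrow> S = T)"

definition op_id :: "'a operator" where
  "op_id x = {x}"

definition op_add :: "'a::plus operator \<Rightarrow> 'a operator \<Rightarrow> 'a operator" where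
  "op_add S T x = {u + v | u v. u \<in> S x \<and> v \<in> T x}"

definition op_scale :: "real \<Rightarrow> 'a::real_vector operator \<Rightarrow> 'a operator" where
  "op_scale c T x = (\<lambda>u. c *\<^sub>R u) ` T x"

definition op_inverse :: "'a operator \<Rightarrow> 'a operator" where
  "op_inverse T y = {x. y \<in> T x}"

text \<open>
  The proximal mapping \<open>P\<^sub>c = (I + c T)\<^sup>-\<^sup>1\<close> as a function. For maximal monotone \<open>T\<close> on a
  Hilbert space and \<open>c > 0\<close> every value of the inverse is a singleton (Minty), so the
  description operator is well defined there.
\<close>

definition prox_map :: "'a::real_vector operator \<Rightarrow> real \<Rightarrow> 'a \<Rightarrow> 'a" where
  "prox_map T c z = (THE p. p \<in> op_inverse (op_add op_id (op_scale c T)) z)"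

definition prox_residual :: "'a::real_vector operator \<Rightarrow> real \<Rightarrow> 'a \<Rightarrow> 'a" where
  "prox_residual T c z = z - prox_map T c z"

definition halpern_iteration ::
  "(nat \<Rightarrow> 'a::real_vector) \<Rightarrow> (nat \<Rightarrow> 'a) \<Rightarrow> bool" where
  "halpern_iteration z zbar \<longleftrightarrow>
     (\<forall>k. z (Suc k) = (1 / (real k + 2)) *\<^sub>R z 0 + ((real k + 1) / (real k + 2)) *\<^sub>R zbar k)"

definition criterion_A ::
  "'a::real_normed_vector operator \<Rightarrow> (nat \<Rightarrow> real) \<Rightarrow> (nat \<Rightarrow> real) \<Rightarrow>
     (nat \<Rightarrow> 'a) \<Rightarrow> (nat \<Rightarrow> 'a) \<Rightarrow> bool" where
  "criterion_A T c \<epsilon> z zbar \<longleftrightarrow>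
     (\<forall>k. \<epsilon> k \<ge> 0) \<and> summable \<epsilon> \<and>
     (\<forall>k. norm (zbar k - prox_map T (c k) (z k)) \<le> \<epsilon> k)"

text \<open>
  The weak topology is the coarsest one for which all continuous linear functionals are
  continuous; as \<open>U = UNIV\<close> is allowed, its carrier is the whole space.
\<close>

definition weak_topology :: "'a::real_normed_vector topology" where
  "weak_topology =
     topology_generated_by {f -` U | (f :: 'a \<Rightarrow> real) U. bounded_linear f \<and> open U}"

end

theory Submission imports Defs
begin

text \<open>
  The iterates in fact converge strongly. Let \<open>p\<close> be the limit of \<open>P\<^sub>t(z\<^sup>0)\<close> as \<open>t \<rightarrow> \<infinity>\<close>, a zero
  of \<open>T\<close>. Firm nonexpansiveness bounds the squared distance \<open>s\<close> to \<open>p\<close> by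
  \<open>s' \<le> (1 - \<alpha>) (s - r\<^sup>2) + \<alpha> b\<close> up to summable errors, where \<open>\<alpha> = 1 / (k + 2)\<close>, \<open>r\<close> is the
  residual \<open>\<parallel>Q(z)\<parallel>\<close>, and \<open>b\<close> is bounded and eventually arbitrarily small whenever \<open>r\<close> is small.
  If \<open>r\<close> is not small, then \<open>r\<^sup>2\<close> outweighs \<open>\<alpha> b\<close> for large \<open>k\<close>. So in either case
  \<open>s' \<le> (1 - \<alpha>) s + \<alpha> e\<close> eventually, for every \<open>e > 0\<close>, which forces \<open>s \<rightarrow> 0\<close>.
\<close>

section \<open>Minty's theorem by convex minimisation\<close>

text \<open>The midpoint of two points of \<open>A\<close> lies in \<open>A\<close>, and by the
  parallelogram identity its value is the mean of theirs minus an eighth of the squared distance of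
  the first components. No value lies below the infimum, so the first components of a minimising
  sequence are Cauchy; the second ones then converge because the values do.\<close>

lemma strongly_convex_minimizer:
  fixes A :: "('b::{real_inner, complete_space} \<times> real) set"
  assumes "closed A" and "convex A" and "A \<noteq> {}"
    and below: "\<And>q t. (q, t) \<in> A \<Longrightarrow> b \<le> t + (norm q)\<^sup>2 / 2"
  obtains q t where "(q, t) \<in> A"
    and "\<And>r s. (r, s) \<in> A \<Longrightarrow> t + (norm q)\<^sup>2 / 2 \<le> s + (norm r)\<^sup>2 / 2"
proof -
  define g where "g = (\<lambda>(q::'b, t). t + (norm q)\<^sup>2 / 2)"
  define m where "m = Inf (g ` A)"
  have bdd: "bdd_below (g ` A)"
    using below by (auto simp: g_def intro!: bdd_belowI[of _ b])
  have m_le: "m \<le> g x" if "x \<in> A" for x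
    unfolding m_def using bdd that by (simp add: cInf_lower)
  have "\<exists>x\<in>A. g x < m + 1 / real (Suc n)" for n
  proof -
    have "Inf (g ` A) < m + 1 / real (Suc n)"
      unfolding m_def by simp
    then show ?thesis
      using cInf_lessD[of "g ` A"] \<open>A \<noteq> {}\<close> by auto
  qed
  then obtain X where X: "\<And>n. X n \<in> A" "\<And>n. g (X n) < m + 1 / real (Suc n)"
    by metis
  define Q where "Q n = fst (X n)" for n
  define R where "R n = snd (X n)" for n
  have QR: "(Q n, R n) \<in> A" for n
    using X(1)[of n] by (simp add: Q_def R_def)
  have gQR: "g (X n) = R n + (norm (Q n))\<^sup>2 / 2" for n
    by (simp add: g_def Q_def R_def case_prod_beta)
  have gap: "(norm (Q i - Q j))\<^sup>2 \<le> 4 * (1 / real (Suc i)) + 4 * (1 / real (Suc j))" for i j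
  proof -
    have "(1/2) *\<^sub>R X i + (1/2) *\<^sub>R X j \<in> A"
      using convexD[OF \<open>convex A\<close> X(1) X(1)] by simp
    from m_le[OF this]
    have "m \<le> (R i + R j) / 2 + (norm ((1/2) *\<^sub>R (Q i + Q j)))\<^sup>2 / 2"
      by (simp add: g_def case_prod_beta Q_def R_def scaleR_add_right add_divide_distrib)
    moreover have "(norm ((1/2) *\<^sub>R (Q i + Q j)))\<^sup>2
        = (norm (Q i))\<^sup>2 / 2 + (norm (Q j))\<^sup>2 / 2 - (norm (Q i - Q j))\<^sup>2 / 4"
      by (simp add: power2_norm_eq_inner inner_commute algebra_simps add_divide_distrib diff_divide_distrib)
    ultimately show ?thesis
      using X(2)[of i] X(2)[of j] unfolding gQR by argo
  qed
  have "Cauchy Q"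
  proof (rule CauchyI)
    fix e :: real assume "0 < e"
    obtain N where N: "1 / real (Suc N) < e\<^sup>2 / 8"
      using nat_approx_posE[of "e\<^sup>2 / 8"] \<open>0 < e\<close> by auto
    have "norm (Q i - Q j) < e" if "N \<le> i" "N \<le> j" for i j
    proof -
      have "1 / real (Suc i) \<le> 1 / real (Suc N)" "1 / real (Suc j) \<le> 1 / real (Suc N)"
        using that by (auto intro!: divide_left_mono)
      then have "(norm (Q i - Q j))\<^sup>2 < e\<^sup>2"
        using gap[of i j] N by linarith
      then show ?thesis
        using \<open>0 < e\<close> by (simp add: power2_less_imp_less)
    qed
    then show "\<exists>M. \<forall>i\<ge>M. \<forall>j\<ge>M. norm (Q i - Q j) < e" by blast
  qed
  then obtain q where q: "Q \<longlonglongrightarrow> q"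
    using Cauchy_convergent convergent_def by blast
  have gX: "(\<lambda>n. g (X n)) \<longlonglongrightarrow> m"
  proof (rule tendsto_sandwich[OF _ _ tendsto_const])
    show "(\<lambda>n. m + 1 / real (Suc n)) \<longlonglongrightarrow> m"
      using tendsto_add[OF tendsto_const[of m] LIMSEQ_Suc[OF lim_1_over_n]] by simp
    show "\<forall>\<^sub>F n in sequentially. g (X n) \<le> m + 1 / real (Suc n)"
      using X(2) by (intro always_eventually allI less_imp_le)
    show "\<forall>\<^sub>F n in sequentially. m \<le> g (X n)"
      by (intro always_eventually allI m_le X(1))
  qed
  \<comment> \<open>The height at which the value over \<open>q\<close> is exactly the
    infimum.\<close>
  define t where "t = m - (norm q)\<^sup>2 / 2"
  have "(\<lambda>n. g (X n) - (norm (Q n))\<^sup>2 / 2) \<longlonglongrightarrow> t"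
    unfolding t_def by (intro tendsto_intros gX q) simp
  then have "R \<longlonglongrightarrow> t"
    by (simp add: gQR)
  then have "(q, t) \<in> A"
    using closed_sequentially[OF \<open>closed A\<close> QR tendsto_Pair[OF q]] by blast
  then show ?thesis
    using that[of q t] m_le by (auto simp: t_def g_def)
qed

text \<open>Moving from the minimiser a fraction \<open>l\<close> of the way towards
  \<open>(r, s)\<close> changes the value by \<open>l * (D + l * K)\<close>. This is nonnegative for
  all small \<open>l\<close>, hence \<open>D\<close> is nonnegative.\<close>

lemma strongly_convex_first_order:
  fixes A :: "('b::real_inner \<times> real) set"
  assumes "convex A" and "(q, t) \<in> A" and "(r, s) \<in> A"
    and min: "\<And>r s. (r, s) \<in> A \<Longrightarrow> t + (norm q)\<^sup>2 / 2 \<le> s + (norm r)\<^sup>2 / 2"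
  shows "t + (norm q)\<^sup>2 \<le> s + q \<bullet> r"
proof -
  define D where "D = s - t + q \<bullet> (r - q)"
  define K where "K = (norm (r - q))\<^sup>2 / 2"
  have "0 \<le> D + 1 / real (Suc n) * K" for n
  proof -
    define l where "l = 1 / real (Suc n)"
    have l: "0 < l" "l \<le> 1" by (auto simp: l_def)
    have "(1 - l) *\<^sub>R (q, t) + l *\<^sub>R (r, s) \<in> A"
      using convexD[OF assms(1-3), of "1 - l" l] l by simp
    then have "(q + l *\<^sub>R (r - q), t + l * (s - t)) \<in> A"
      by (simp add: algebra_simps)
    from min[OF this] have "0 \<le> l * (D + l * K)"
      unfolding D_def K_def
      by (simp add: power2_norm_eq_inner inner_commute algebra_simps add_divide_distrib diff_divide_distrib)
    then show ?thesis
      using l unfolding l_def[symmetric] by (simp add: zero_le_mult_iff)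
  qed
  moreover have "(\<lambda>n. D + 1 / real (Suc n) * K) \<longlonglongrightarrow> D + 0 * K"
    by (intro tendsto_intros LIMSEQ_Suc[OF lim_1_over_n])
  ultimately have "0 \<le> D"
    using LIMSEQ_le_const[of _ "D + 0 * K" 0] by auto
  then show ?thesis
    by (simp add: D_def inner_diff_right power2_norm_eq_inner)
qed

text \<open>
  The minimisation runs over the epigraph of the Fitzpatrick function
  \<open>(x, w) \<mapsto> sup {\<langle>x, v\<rangle> + \<langle>u, w\<rangle> - \<langle>u, v\<rangle> | (u, v) \<in> G}\<close>, which dominates the duality
  product. First-order optimality at the minimiser \<open>(x, w)\<close> says that \<open>(-w, -x)\<close> is
  monotonically related to \<open>G\<close>.
\<close>

lemma minty_graph:
  fixes G :: "('a::{real_inner, complete_space} \<times> 'a) set"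
  assumes mono: "\<And>x u y v. (x, u) \<in> G \<Longrightarrow> (y, v) \<in> G \<Longrightarrow> 0 \<le> (x - y) \<bullet> (u - v)"
    and max: "\<And>x u. (\<And>y v. (y, v) \<in> G \<Longrightarrow> 0 \<le> (x - y) \<bullet> (u - v)) \<Longrightarrow> (x, u) \<in> G"
  obtains x where "(x, - x) \<in> G"
proof -
  define A where "A = (\<Inter>(u, v)\<in>G. {p :: ('a \<times> 'a) \<times> real. (v, u) \<bullet> fst p - snd p \<le> u \<bullet> v})"
  have A_iff: "((x, w), t) \<in> A \<longleftrightarrow> (\<forall>(u, v)\<in>G. v \<bullet> x + u \<bullet> w - t \<le> u \<bullet> v)" for x w t
    by (auto simp: A_def)
  \<comment> \<open>Each constraint is a halfspace of the product space, so \<open>A\<close> is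
    closed and convex as an intersection of halfspaces.\<close>
  have lin: "(v, u) \<bullet> fst p - snd p = ((v, u), - 1) \<bullet> p"
    for u v :: 'a and p :: "('a \<times> 'a) \<times> real"
    by (cases p) auto
  have "closed A"
    unfolding A_def by (auto simp: lin closed_halfspace_le)
  moreover have "convex A"
    unfolding A_def by (auto simp: lin intro!: convex_INT convex_halfspace_le)
  moreover have graph_A: "((x, u), x \<bullet> u) \<in> A" if "(x, u) \<in> G" for x u
    using mono[OF that] unfolding A_iff
    by (fastforce simp: inner_simps inner_commute)
  \<comment> \<open>For empty \<open>G\<close> the premise of \<open>max\<close> would hold
    vacuously.\<close>
  moreover have "G \<noteq> {}"
    using max by blast
  \<comment> \<open>Otherwise the constraints make \<open>(x, w)\<close> monotonically related to
    \<open>G\<close>, hence a member of it, and the constraint belonging to \<open>(x, w)\<close>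
    itself is violated.\<close>
  moreover have fitz: "x \<bullet> w \<le> t" if "((x, w), t) \<in> A" for x w t
  proof (rule ccontr)
    assume less: "\<not> x \<bullet> w \<le> t"
    have "(x, w) \<in> G"
    proof (rule max)
      fix y v assume "(y, v) \<in> G"
      with that less show "0 \<le> (x - y) \<bullet> (w - v)"
        unfolding A_iff by (fastforce simp: inner_simps inner_commute)
    qed
    then show False
      using that less unfolding A_iff by (fastforce simp: inner_commute)
  qed
  moreover have bound: "0 \<le> t + (norm p)\<^sup>2 / 2" if "(p, t) \<in> A" for p t
  proof (cases p)
    case (Pair x w)
    have "0 \<le> (x + w) \<bullet> (x + w)" by simp
    then show ?thesis
      using fitz[of x w t] that unfolding Pair
      by (simp add: power2_norm_eq_inner inner_simps inner_commute add_divide_distrib)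
  qed
  ultimately obtain p t where p: "(p, t) \<in> A"
    and min: "\<And>r s. (r, s) \<in> A \<Longrightarrow> t + (norm p)\<^sup>2 / 2 \<le> s + (norm r)\<^sup>2 / 2"
    using strongly_convex_minimizer[of A 0] by (metis all_not_in_conv surj_pair)
  obtain x w where pxw: "p = (x, w)" by (cases p)
  \<comment> \<open>First-order optimality tested at the graph point of height
    \<open>u \<bullet> v\<close>, with \<open>t\<close> bounded below by
    \<open>x \<bullet> w\<close>.\<close>
  have related: "(norm (x + w))\<^sup>2 \<le> (u + w) \<bullet> (v + x)" if "(u, v) \<in> G" for u v
    using strongly_convex_first_order[OF \<open>convex A\<close> p graph_A[OF that] min] fitz[of x w t] p
    unfolding pxw by (simp add: power2_norm_eq_inner inner_simps inner_commute)
  have "(- w, - x) \<in> G"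
  proof (rule max)
    fix y v assume "(y, v) \<in> G"
    from related[OF this] have "0 \<le> (y + w) \<bullet> (v + x)"
      using zero_le_power2 order_trans by blast
    then show "0 \<le> (- w - y) \<bullet> (- x - v)"
      by (simp add: inner_simps inner_commute)
  qed
  \<comment> \<open>At \<open>(- w, - x)\<close> the right-hand side of \<open>related\<close>
    vanishes.\<close>
  moreover from related[OF this] have "x = - w"
    by (simp add: eq_neg_iff_add_eq_0)
  ultimately show ?thesis
    using that[of "- w"] by simp
qed

section \<open>Maximal monotone operators and their proximal mappings\<close>

text \<open>Adding the pair \<open>(x, u)\<close> to the graph keeps it monotone, so by maximality
  it was there already.\<close>

lemma maximal_monotoneD:
  assumes "maximal_monotone T"
    and rel: "\<And>y v. v \<in> T y \<Longrightarrow> 0 \<le> (x - y) \<bullet> (u - v)"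
  shows "u \<in> T x"
proof -
  define S where "S = T(x := insert u (T x))"
  have mono: "0 \<le> (a - b) \<bullet> (p - q)" if "p \<in> T a" "q \<in> T b" for a b p q
    using assms(1) that by (auto simp: maximal_monotone_def monotone_operator_def)
  have rel': "0 \<le> (y - x) \<bullet> (v - u)" if "v \<in> T y" for y v
    using rel[OF that] by (simp add: inner_simps)
  have "monotone_operator S"
    unfolding monotone_operator_def S_def
    using mono rel rel' by (auto split: if_splits)
  moreover have "T \<le> S"
    by (auto simp: S_def le_fun_def)
  ultimately have "S = T"
    using assms(1) by (auto simp: maximal_monotone_def)
  then show ?thesis
    by (metis S_def fun_upd_same insertI1)
qed

lemma maximal_monotone_mono:
  assumes "maximal_monotone T" "u \<in> T x" "v \<in> T y"
  shows "0 \<le> (x - y) \<bullet> (u - v)"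
  using assms by (auto simp: maximal_monotone_def monotone_operator_def)

lemma maximal_monotone_closed_graph:
  assumes T: "maximal_monotone T"
    and "\<And>n. u n \<in> T (x n)" and "x \<longlonglongrightarrow> x'" and "u \<longlonglongrightarrow> u'"
  shows "u' \<in> T x'"
proof (rule maximal_monotoneD[OF T])
  fix y v assume v: "v \<in> T y"
  have "(\<lambda>n. (x n - y) \<bullet> (u n - v)) \<longlonglongrightarrow> (x' - y) \<bullet> (u' - v)"
    by (intro tendsto_intros assms)
  then show "0 \<le> (x' - y) \<bullet> (u' - v)"
    by (rule LIMSEQ_le_const) (use maximal_monotone_mono[OF T] assms(2) v in blast)
qed

text \<open>Existence is \<open>minty_graph\<close> for the operator sending \<open>p\<close> to
  \<open>c T(p) - x\<close>: a pair \<open>(p, - p)\<close> in its graph solves the inclusion.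
  Uniqueness follows from monotonicity, so the description in \<open>prox_map\<close> denotes this
  solution.\<close>

lemma prox_graph:
  fixes T :: "'a::{real_inner, complete_space} operator"
  assumes T: "maximal_monotone T" and "0 < c"
  shows "(1 / c) *\<^sub>R (x - prox_map T c x) \<in> T (prox_map T c x)"
proof -
  have iff: "p \<in> op_inverse (op_add op_id (op_scale c T)) x \<longleftrightarrow> (1 / c) *\<^sub>R (x - p) \<in> T p" for p
  proof -
    have "x = p + c *\<^sub>R v \<longleftrightarrow> v = (1 / c) *\<^sub>R (x - p)" for v
    proof
      show "x = p + c *\<^sub>R v" if "v = (1 / c) *\<^sub>R (x - p)"
        using \<open>0 < c\<close> that by simp
    qed (use \<open>0 < c\<close> in simp)
    moreover have "p \<in> op_inverse (op_add op_id (op_scale c T)) x \<longleftrightarrow> (\<exists>v\<in>T p. x = p + c *\<^sub>R v)"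
      by (auto simp: op_inverse_def op_add_def op_id_def op_scale_def)
    ultimately show ?thesis by simp
  qed
  define G where "G = {(p, c *\<^sub>R v - x) | p v. v \<in> T p}"
  have G_iff: "(p, u) \<in> G \<longleftrightarrow> (1 / c) *\<^sub>R (u + x) \<in> T p" for p u
  proof -
    have "u = c *\<^sub>R v - x \<longleftrightarrow> v = (1 / c) *\<^sub>R (u + x)" for v
    proof
      show "u = c *\<^sub>R v - x" if "v = (1 / c) *\<^sub>R (u + x)"
        using \<open>0 < c\<close> that by simp
    qed (use \<open>0 < c\<close> in simp)
    moreover have "(p, u) \<in> G \<longleftrightarrow> (\<exists>v\<in>T p. u = c *\<^sub>R v - x)"
      by (auto simp: G_def)
    ultimately show ?thesis by simp
  qed
  have scale: "(p - q) \<bullet> ((1 / c) *\<^sub>R (u + x) - (1 / c) *\<^sub>R (v + x)) = (1 / c) * ((p - q) \<bullet> (u - v))"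
    for p q u v
    by (simp flip: scaleR_diff_right)
  obtain p where "(p, - p) \<in> G"
  proof (rule minty_graph)
    fix p u q v assume "(p, u) \<in> G" "(q, v) \<in> G"
    then have "0 \<le> (1 / c) * ((p - q) \<bullet> (u - v))"
      unfolding G_iff scale[symmetric] by (rule maximal_monotone_mono[OF T])
    then show "0 \<le> (p - q) \<bullet> (u - v)"
      using \<open>0 < c\<close> by (simp add: zero_le_divide_iff)
  next
    fix p u assume rel: "\<And>q v. (q, v) \<in> G \<Longrightarrow> 0 \<le> (p - q) \<bullet> (u - v)"
    show "(p, u) \<in> G"
      unfolding G_iff
    proof (rule maximal_monotoneD[OF T])
      fix q v assume "v \<in> T q"
      then have "0 \<le> (p - q) \<bullet> (u - (c *\<^sub>R v - x))"
        by (intro rel) (auto simp: G_def)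
      also have "u - (c *\<^sub>R v - x) = c *\<^sub>R ((1 / c) *\<^sub>R (u + x) - v)"
        using \<open>0 < c\<close> by (simp add: algebra_simps)
      finally show "0 \<le> (p - q) \<bullet> ((1 / c) *\<^sub>R (u + x) - v)"
        using \<open>0 < c\<close> by (simp add: zero_le_mult_iff)
    qed
  qed
  then have p: "(1 / c) *\<^sub>R (x - p) \<in> T p"
    by (simp add: G_iff)
  have "prox_map T c x = p"
    unfolding prox_map_def iff
  proof (rule the_equality)
    fix q assume "(1 / c) *\<^sub>R (x - q) \<in> T q"
    from maximal_monotone_mono[OF T this p]
    have "0 \<le> (1 / c) * - ((norm (q - p))\<^sup>2)"
      by (simp add: power2_norm_eq_inner inner_commute algebra_simps flip: scaleR_diff_right)
    then have "(norm (q - p))\<^sup>2 \<le> 0"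
      using \<open>0 < c\<close> by (simp add: zero_le_divide_iff divide_le_0_iff)
    then show "q = p" by simp
  qed (fact p)
  with p show ?thesis by simp
qed

text \<open>Expanding the right-hand side around the proximal point leaves a cross term, which is
  nonnegative by monotonicity against the pair \<open>(p, 0)\<close>.\<close>

lemma prox_firmly_nonexpansive:
  fixes T :: "'a::{real_inner, complete_space} operator"
  assumes T: "maximal_monotone T" and "0 < c" and "0 \<in> T p"
  shows "(norm (prox_map T c x - p))\<^sup>2 + (norm (x - prox_map T c x))\<^sup>2 \<le> (norm (x - p))\<^sup>2"
proof -
  define y where "y = prox_map T c x"
  have "0 \<le> (1 / c) * ((y - p) \<bullet> (x - y))"
    using maximal_monotone_mono[OF T prox_graph[OF T \<open>0 < c\<close>, of x] \<open>0 \<in> T p\<close>]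
    by (simp add: y_def)
  then have "0 \<le> (y - p) \<bullet> (x - y)"
    using \<open>0 < c\<close> by (simp add: zero_le_divide_iff)
  then show ?thesis
    unfolding y_def[symmetric] by (simp add: power2_norm_eq_inner inner_simps inner_commute)
qed

lemma prox_norm_le:
  fixes T :: "'a::{real_inner, complete_space} operator"
  assumes "maximal_monotone T" and "0 < c" and "0 \<in> T p"
  shows "norm (prox_map T c x - p) \<le> norm (x - p)"
    and "norm (x - prox_map T c x) \<le> norm (x - p)"
proof -
  have "(norm (prox_map T c x - p))\<^sup>2 \<le> (norm (x - p))\<^sup>2"
    and "(norm (x - prox_map T c x))\<^sup>2 \<le> (norm (x - p))\<^sup>2"
    using prox_firmly_nonexpansive[OF assms, of x] zero_le_power2[of "norm (prox_map T c x - p)"]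
      zero_le_power2[of "norm (x - prox_map T c x)"]
    by linarith+
  then show "norm (prox_map T c x - p) \<le> norm (x - p)"
    and "norm (x - prox_map T c x) \<le> norm (x - p)"
    by (auto dest: power2_le_imp_le)
qed

section \<open>The proximal path as the parameter tends to infinity\<close>

text \<open>In particular the distance from \<open>x\<close> to its proximal point grows with the
  parameter, and once it is bounded the path is Cauchy.\<close>

lemma prox_path_dist:
  fixes T :: "'a::{real_inner, complete_space} operator"
  assumes T: "maximal_monotone T" and "0 < s" and "s < t"
  shows "(norm (prox_map T s x - prox_map T t x))\<^sup>2
    \<le> (norm (x - prox_map T t x))\<^sup>2 - (norm (x - prox_map T s x))\<^sup>2"
proof -
  define a where "a = x - prox_map T s x"
  define b where "b = x - prox_map T t x"
  have "0 < t" using assms by simp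
  have "0 \<le> (prox_map T s x - prox_map T t x) \<bullet> ((1 / s) *\<^sub>R a - (1 / t) *\<^sub>R b)"
    using maximal_monotone_mono[OF T prox_graph[OF T \<open>0 < s\<close>] prox_graph[OF T \<open>0 < t\<close>]]
    by (simp add: a_def b_def)
  also have "prox_map T s x - prox_map T t x = b - a"
    by (simp add: a_def b_def)
  finally have "0 \<le> s * t * ((b - a) \<bullet> ((1 / s) *\<^sub>R a - (1 / t) *\<^sub>R b))"
    using \<open>0 < s\<close> \<open>0 < t\<close> by simp
  also have "\<dots> = (s + t) * (a \<bullet> b) - t * (a \<bullet> a) - s * (b \<bullet> b)"
    using \<open>0 < s\<close> \<open>0 < t\<close> by (simp add: inner_simps inner_commute field_simps)
  finally have mono: "t * (a \<bullet> a) + s * (b \<bullet> b) \<le> (s + t) * (a \<bullet> b)"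
    by simp
  have "0 \<le> (s + t) * ((b - a) \<bullet> (b - a))"
    using \<open>0 < s\<close> \<open>0 < t\<close> by simp
  with mono have "0 \<le> (t - s) * (b \<bullet> b - a \<bullet> a)"
    by (simp add: inner_commute algebra_simps)
  then have incr: "a \<bullet> a \<le> b \<bullet> b"
    using \<open>s < t\<close> by (simp add: zero_le_mult_iff)
  \<comment> \<open>Expanding the square and bounding the cross term by twice \<open>mono\<close>.
    The factor \<open>t - s\<close> can then be enlarged to \<open>s + t\<close> thanks to
    \<open>incr\<close>.\<close>
  have "(s + t) * ((b - a) \<bullet> (b - a)) \<le> (t - s) * (b \<bullet> b - a \<bullet> a)"
    using mono by (simp add: inner_commute algebra_simps)
  also have "\<dots> \<le> (s + t) * (b \<bullet> b - a \<bullet> a)"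
    using incr \<open>0 < s\<close> by (intro mult_right_mono) auto
  finally have "(b - a) \<bullet> (b - a) \<le> b \<bullet> b - a \<bullet> a"
    using \<open>0 < s\<close> \<open>0 < t\<close> by (simp add: mult_le_cancel_left)
  then show ?thesis
    by (simp add: power2_norm_eq_inner a_def b_def)
qed

lemma prox_path_converges:
  fixes T :: "'a::{real_inner, complete_space} operator"
  assumes T: "maximal_monotone T" and "0 \<in> T q"
  obtains p where "0 \<in> T p" and "(\<lambda>n. prox_map T (real (Suc n)) x) \<longlonglongrightarrow> p"
proof -
  define y where "y n = prox_map T (real (Suc n)) x" for n
  define d where "d n = (norm (x - y n))\<^sup>2" for n
  have dist_le: "(norm (y i - y j))\<^sup>2 \<le> d j - d i" if "i \<le> j" for i j
    using prox_path_dist[OF T, of "real (Suc i)" "real (Suc j)" x] that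
    by (cases "i = j") (auto simp: y_def d_def)
  have y_bound: "norm (x - y n) \<le> norm (x - q)" for n
    unfolding y_def by (rule prox_norm_le[OF T _ \<open>0 \<in> T q\<close>]) simp
  have "incseq d"
    unfolding incseq_def using dist_le zero_le_power2 by (smt (verit))
  moreover have "d n \<le> (norm (x - q))\<^sup>2" for n
    unfolding d_def using y_bound by (simp add: power_mono)
  ultimately have "Cauchy d"
    using incseq_convergent[of d] by (metis LIMSEQ_imp_Cauchy)
  have "Cauchy y"
  proof (rule CauchyI)
    fix e :: real assume "0 < e"
    then obtain N where N: "\<And>i j. N \<le> i \<Longrightarrow> N \<le> j \<Longrightarrow> norm (d i - d j) < e\<^sup>2"
      using CauchyD[OF \<open>Cauchy d\<close>, of "e\<^sup>2"] by auto
    have "norm (y i - y j) < e" if "N \<le> i" "N \<le> j" for i j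
    proof -
      have "(norm (y i - y j))\<^sup>2 \<le> \<bar>d i - d j\<bar>"
        using dist_le[of i j] dist_le[of j i] by (cases "i \<le> j") (auto simp: norm_minus_commute)
      then have "(norm (y i - y j))\<^sup>2 < e\<^sup>2"
        using N[OF that] by simp
      then show ?thesis
        using \<open>0 < e\<close> by (simp add: power2_less_imp_less)
    qed
    then show "\<exists>M. \<forall>i\<ge>M. \<forall>j\<ge>M. norm (y i - y j) < e" by blast
  qed
  then obtain p where p: "y \<longlonglongrightarrow> p"
    using Cauchy_convergent convergent_def by blast
  \<comment> \<open>These are elements of \<open>T (y n)\<close>; closedness of the graph carries
    the inclusion to the limit.\<close>
  have "(\<lambda>n. (1 / real (Suc n)) *\<^sub>R (x - y n)) \<longlonglongrightarrow> 0 *\<^sub>R (x - p)"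
    by (intro tendsto_intros p LIMSEQ_Suc[OF lim_1_over_n])
  then have "0 \<in> T p"
    using maximal_monotone_closed_graph[OF T _ p, of "\<lambda>n. (1 / real (Suc n)) *\<^sub>R (x - y n)"]
      prox_graph[OF T, of "real (Suc _)" x] by (simp add: y_def)
  then show ?thesis
    using that p unfolding y_def by blast
qed

section \<open>Recursive inequalities with Halpern weights\<close>

text \<open>For each \<open>e\<close>, the quantity \<open>(k + 1) * (s k - e)\<close> is eventually
  nonincreasing, hence bounded above by some \<open>C\<close>, and \<open>s k\<close> exceeds
  \<open>e\<close> by at most \<open>C / (k + 1)\<close>.\<close>

lemma halpern_recursion_tendsto_0:
  fixes s \<eta> b :: "nat \<Rightarrow> real"
  assumes s: "\<And>k. 0 \<le> s k" and b: "\<And>k. b k \<le> B"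
    and rec: "\<And>k. s (Suc k) \<le> ((real k + 1) * (s k - \<eta> k) + b k) / (real k + 2)"
    and eta: "\<And>k. 0 \<le> \<eta> k"
    and small: "\<And>e. 0 < e \<Longrightarrow> \<exists>d>0. \<forall>\<^sub>F k in sequentially. \<eta> k < d \<longrightarrow> b k < e"
  shows "s \<longlonglongrightarrow> 0"
proof (rule LIMSEQ_I)
  fix e' :: real assume "0 < e'"
  define e where "e = e' / 2"
  have "0 < e" using \<open>0 < e'\<close> by (simp add: e_def)
  obtain d N where "0 < d" and N: "\<And>k. N \<le> k \<Longrightarrow> \<eta> k < d \<Longrightarrow> b k < e"
    using small[OF \<open>0 < e\<close>] unfolding eventually_sequentially by blast
  \<comment> \<open>From \<open>N'\<close> on, a value of \<open>\<eta>\<close> that is at least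
    \<open>d\<close> outweighs the crude bound \<open>B\<close> once multiplied by
    \<open>k + 1\<close>.\<close>
  obtain N' :: nat where N': "B / d < real N'"
    using reals_Archimedean2 by blast
  define m where "m = max N N'"
  have step: "(real (Suc k) + 1) * (s (Suc k) - e) \<le> (real k + 1) * (s k - e)" if "m \<le> k" for k
  proof -
    have "b k \<le> (real k + 1) * \<eta> k + e"
    proof (cases "\<eta> k < d")
      case True
      then show ?thesis
        using N[of k] that eta[of k] by (auto simp: m_def intro: add_increasing)
    next
      case False
      have "B \<le> real N' * d"
        using N' \<open>0 < d\<close> by (simp add: field_simps)
      also have "\<dots> \<le> (real k + 1) * \<eta> k"
        using that False \<open>0 < d\<close> by (intro mult_mono) (auto simp: m_def)
      finally show ?thesis
        using b[of k] \<open>0 < e\<close> by linarith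
    qed
    moreover have "(real k + 2) * s (Suc k) \<le> (real k + 1) * (s k - \<eta> k) + b k"
      using rec[of k] by (simp add: pos_le_divide_eq mult.commute)
    ultimately show ?thesis
      by (simp add: algebra_simps)
  qed
  define C where "C = (real m + 1) * (s m - e)"
  have C: "(real k + 1) * (s k - e) \<le> C" if "m \<le> k" for k
    using that
  proof (induction k rule: dec_induct)
    case base
    then show ?case by (simp add: C_def)
  next
    case (step k)
    then show ?case using \<open>\<And>k. m \<le> k \<Longrightarrow> _ k\<close>[of k] by linarith
  qed
  obtain N'' :: nat where N'': "C / e < real N''"
    using reals_Archimedean2 by blast
  have "norm (s k - 0) < e'" if "max m N'' \<le> k" for k
  proof -
    have "m \<le> k" using that by simp
    have "C < real N'' * e"
      using N'' \<open>0 < e\<close> by (simp add: field_simps)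
    also have "\<dots> \<le> (real k + 1) * e"
      using that \<open>0 < e\<close> by (intro mult_right_mono) auto
    finally have "(real k + 1) * (s k - e) < (real k + 1) * e"
      using C[OF \<open>m \<le> k\<close>] by linarith
    then have "s k - e < e"
      by (rule mult_left_less_imp_less) simp
    then show ?thesis
      using s[of k] by (simp add: e_def)
  qed
  then show "\<exists>N. \<forall>k\<ge>N. norm (s k - 0) < e'" by blast
qed

text \<open>Adding the tails of \<open>\<Sum> \<epsilon>\<close> to \<open>s\<close> absorbs the summable errors.\<close>

lemma halpern_recursion_error_tendsto_0:
  fixes s \<eta> b \<epsilon> :: "nat \<Rightarrow> real"
  assumes s: "\<And>k. 0 \<le> s k" and b: "\<And>k. b k \<le> B"
    and \<epsilon>: "\<And>k. 0 \<le> \<epsilon> k" "summable \<epsilon>"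
    and rec: "\<And>k. s (Suc k) \<le> ((real k + 1) * (s k - \<eta> k) + b k) / (real k + 2) + \<epsilon> k"
    and eta: "\<And>k. 0 \<le> \<eta> k"
    and small: "\<And>e. 0 < e \<Longrightarrow> \<exists>d>0. \<forall>\<^sub>F k in sequentially. \<eta> k < d \<longrightarrow> b k < e"
  shows "s \<longlonglongrightarrow> 0"
proof -
  define \<sigma> where "\<sigma> k = (\<Sum>i. \<epsilon> (i + k))" for k
  have sum_shift: "summable (\<lambda>i. \<epsilon> (i + k))" for k
    using \<epsilon>(2) by (simp add: summable_iff_shift)
  have \<sigma>_nonneg: "0 \<le> \<sigma> k" for k
    unfolding \<sigma>_def using \<epsilon>(1) by (intro suminf_nonneg sum_shift)
  have \<sigma>_Suc: "\<sigma> k = \<epsilon> k + \<sigma> (Suc k)" for k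
    using suminf_split_head[OF sum_shift, of k] by (simp add: \<sigma>_def)
  have \<sigma>_le: "\<sigma> k \<le> \<sigma> 0" for k
  proof (induction k)
    case (Suc k)
    then show ?case
      using \<sigma>_Suc[of k] \<epsilon>(1)[of k] by linarith
  qed simp
  have \<sigma>_lim: "\<sigma> \<longlonglongrightarrow> 0"
  proof (rule LIMSEQ_I)
    fix r :: real assume "0 < r"
    then show "\<exists>N. \<forall>k\<ge>N. norm (\<sigma> k - 0) < r"
      using suminf_exist_split[OF _ \<epsilon>(2)] unfolding \<sigma>_def by simp
  qed
  have "(\<lambda>k. s k + \<sigma> k) \<longlonglongrightarrow> 0"
  \<comment> \<open>\<open>\<sigma> k\<close> is split with weights \<open>(k + 1) / (k + 2)\<close>
    and \<open>1 / (k + 2)\<close>: the first share joins \<open>s k\<close>, the second joins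
    \<open>b k\<close>, which keeps its smallness because \<open>\<sigma>\<close> tends to
    0.\<close>
  proof (rule halpern_recursion_tendsto_0[where \<eta> = \<eta> and b = "\<lambda>k. b k + \<sigma> k" and B = "B + \<sigma> 0"])
    show "s (Suc k) + \<sigma> (Suc k)
        \<le> ((real k + 1) * (s k + \<sigma> k - \<eta> k) + (b k + \<sigma> k)) / (real k + 2)" for k
    proof -
      have "(real k + 1) * (s k + \<sigma> k - \<eta> k) + (b k + \<sigma> k)
          = (real k + 1) * (s k - \<eta> k) + b k + \<sigma> k * (real k + 2)"
        by (simp add: algebra_simps)
      then have "((real k + 1) * (s k + \<sigma> k - \<eta> k) + (b k + \<sigma> k)) / (real k + 2)
          = ((real k + 1) * (s k - \<eta> k) + b k) / (real k + 2) + \<sigma> k"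
        by (simp only: add_divide_distrib) simp
      then show ?thesis
        using rec[of k] \<sigma>_Suc[of k] by linarith
    qed
    show "\<exists>d>0. \<forall>\<^sub>F k in sequentially. \<eta> k < d \<longrightarrow> b k + \<sigma> k < e" if e: "0 < e" for e
    proof -
      obtain d where "0 < d" and d: "\<forall>\<^sub>F k in sequentially. \<eta> k < d \<longrightarrow> b k < e / 2"
        using small[OF half_gt_zero[OF e]] by blast
      have "\<forall>\<^sub>F k in sequentially. \<sigma> k < e / 2"
        using order_tendstoD(2)[OF \<sigma>_lim, of "e / 2"] e by simp
      with d have "\<forall>\<^sub>F k in sequentially. \<eta> k < d \<longrightarrow> b k + \<sigma> k < e"
        by eventually_elim auto
      with \<open>0 < d\<close> show ?thesis by blast
    qed
  qed (use s \<sigma>_nonneg eta b \<sigma>_le in \<open>auto intro: add_mono add_nonneg_nonneg\<close>)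
  from tendsto_diff[OF this \<sigma>_lim] show ?thesis by simp
qed

section \<open>From norm convergence to weak convergence\<close>

lemma limitin_weak_topology:
  assumes "x \<longlonglongrightarrow> l"
  shows "limitin weak_topology x l sequentially"
proof -
  let ?S = "{f -` U | (f :: 'a \<Rightarrow> real) U. bounded_linear f \<and> open U}"
  \<comment> \<open>The zero functional provides the whole space as a generator, so every point lies
    in the carrier.\<close>
  have "UNIV \<in> ?S"
    by (rule CollectI, rule exI[of _ "\<lambda>_. 0"], rule exI[of _ UNIV]) simp
  from Union_upper[OF this] have top: "\<Union> ?S = UNIV"
    by (rule top.extremum_uniqueI)
  have opn: "open U" if "openin weak_topology U" for U :: "'a set"
  proof -
    from that have "generate_topology_on ?S U"
      unfolding weak_topology_def by (rule openin_topology_generated_by)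
    then show ?thesis
    proof induction
      case (Basis s)
      then obtain f :: "'a \<Rightarrow> real" and V where "s = f -` V" "bounded_linear f" "open V"
        by blast
      then show ?case
        by (simp add: open_vimage linear_continuous_on)
    qed auto
  qed
  have "topspace (weak_topology :: 'a topology) = UNIV"
    using top by (simp add: weak_topology_def topology_generated_by_topspace)
  then show ?thesis
    using assms opn by (auto simp: limitin_def dest: topological_tendstoD)
qed

section \<open>Convergence of the inexact Halpern iteration\<close>

lemma halpern_strong_convergence:
  fixes T :: "'a::{real_inner, complete_space} operator"
  assumes T: "maximal_monotone T" and c: "\<And>k. \<delta> \<le> c k" and "0 < \<delta>"
    and halpern: "halpern_iteration z zbar"
    and crit: "criterion_A T c \<epsilon> z zbar"
    and p: "0 \<in> T p" and path: "(\<lambda>n. prox_map T (real (Suc n)) (z 0)) \<longlonglongrightarrow> p"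
  shows "z \<longlonglongrightarrow> p"
proof -
  define P where "P k = prox_map T (c k) (z k)" for k
  define y where "y n = prox_map T (real (Suc n)) (z 0)" for n
  define a where "a = z 0 - p"
  define r where "r k = norm (z k - P k)" for k
  define M where "M = norm a + suminf \<epsilon>"
  have c_pos: "0 < c k" for k
    using c[of k] \<open>0 < \<delta>\<close> by simp
  have \<epsilon>: "\<And>k. 0 \<le> \<epsilon> k" "summable \<epsilon>" and err: "\<And>k. norm (zbar k - P k) \<le> \<epsilon> k"
    using crit by (auto simp: criterion_A_def P_def)
  have partial_sum: "sum \<epsilon> {..<k} \<le> suminf \<epsilon>" for k
    using \<epsilon> by (intro sum_le_suminf) auto
  have z_Suc: "z (Suc k) - p = (1 / (real k + 2)) *\<^sub>R a + ((real k + 1) / (real k + 2)) *\<^sub>R (P k - p)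
      + ((real k + 1) / (real k + 2)) *\<^sub>R (zbar k - P k)" for k
  proof -
    have "(1 / (real k + 2)) *\<^sub>R p + ((real k + 1) / (real k + 2)) *\<^sub>R p = p"
      by (simp add: field_simps flip: scaleR_add_left)
    then show ?thesis
      using halpern by (simp add: halpern_iteration_def a_def algebra_simps)
  qed
  have P_le: "norm (P k - p) \<le> norm (z k - p)" for k
    unfolding P_def by (rule prox_norm_le[OF T c_pos p])
  have w_le: "norm ((1 / (real k + 2)) *\<^sub>R a + ((real k + 1) / (real k + 2)) *\<^sub>R (P k - p)) \<le> R"
    if "norm a \<le> R" "norm (P k - p) \<le> R" for k R
  proof -
    have "norm ((1 / (real k + 2)) *\<^sub>R a + ((real k + 1) / (real k + 2)) *\<^sub>R (P k - p))
        \<le> (1 / (real k + 2)) * norm a + ((real k + 1) / (real k + 2)) * norm (P k - p)"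
      by (rule order_trans[OF norm_triangle_ineq]) simp
    also have "\<dots> \<le> (1 / (real k + 2)) * R + ((real k + 1) / (real k + 2)) * R"
      using that by (intro add_mono mult_left_mono) auto
    also have "\<dots> = R"
      by (simp add: divide_simps) (simp add: algebra_simps)
    finally show ?thesis .
  qed
  have e_le: "norm (((real k + 1) / (real k + 2)) *\<^sub>R (zbar k - P k)) \<le> \<epsilon> k" for k
  proof -
    have "((real k + 1) / (real k + 2)) * norm (zbar k - P k) \<le> 1 * norm (zbar k - P k)"
      by (intro mult_right_mono) auto
    then show ?thesis using err[of k] by simp
  qed
  \<comment> \<open>A convex combination of \<open>a\<close> and \<open>P k - p\<close> stays within
    the current bound, so a step enlarges it by at most \<open>\<epsilon> k\<close>.\<close>
  have z_partial: "norm (z k - p) \<le> norm a + sum \<epsilon> {..<k}" for k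
  proof (induction k)
    case (Suc k)
    have "norm (z (Suc k) - p) \<le> (norm a + sum \<epsilon> {..<k}) + \<epsilon> k"
      unfolding z_Suc
    proof (rule norm_triangle_le, rule add_mono[OF w_le e_le])
      show "norm a \<le> norm a + sum \<epsilon> {..<k}"
        using \<epsilon>(1) by (simp add: sum_nonneg)
      show "norm (P k - p) \<le> norm a + sum \<epsilon> {..<k}"
        using P_le[of k] Suc by simp
    qed
    then show ?case by simp
  qed (simp add: a_def)
  have z_le: "norm (z k - p) \<le> M" for k
    using z_partial[of k] partial_sum[of k] by (simp add: M_def)
  have PM: "norm (P k - p) \<le> M" for k
    using P_le[of k] z_le[of k] by simp
  have "0 \<le> suminf \<epsilon>"
    using \<epsilon> by (intro suminf_nonneg) auto
  then have aM: "norm a \<le> M" and M_nonneg: "0 \<le> M"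
    by (auto simp: M_def)
  have \<epsilon>M: "\<epsilon> k \<le> M" for k
    using partial_sum[of "Suc k"] sum_nonneg[of "{..<k}" \<epsilon>] \<epsilon>(1) by (simp add: M_def add_increasing)
  \<comment> \<open>In the squared norm of the exact step, these are the terms containing
    \<open>a\<close>, with one factor \<open>1 / (k + 2)\<close> taken out.\<close>
  define b where "b k = 2 * ((real k + 1) / (real k + 2)) * (a \<bullet> (P k - p)) + (1 / (real k + 2)) * (norm a)\<^sup>2"
    for k
  have rec: "(norm (z (Suc k) - p))\<^sup>2
      \<le> ((real k + 1) * ((norm (z k - p))\<^sup>2 - (r k)\<^sup>2) + b k) / (real k + 2) + 3 * M * \<epsilon> k" for k
  proof -
    define l where "l = 1 / (real k + 2)"
    define m where "m = (real k + 1) / (real k + 2)"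
    define w where "w = l *\<^sub>R a + m *\<^sub>R (P k - p)"
    define v where "v = m *\<^sub>R (zbar k - P k)"
    have lm: "0 \<le> l" "0 \<le> m" "m \<le> 1"
      by (auto simp: l_def m_def)
    have "(norm (z (Suc k) - p))\<^sup>2 \<le> (norm w + norm v)\<^sup>2"
      unfolding z_Suc w_def v_def l_def m_def by (intro power_mono norm_triangle_ineq) simp
    also have "\<dots> = (norm w)\<^sup>2 + norm v * (2 * norm w + norm v)"
      by (simp add: power2_eq_square algebra_simps)
    also have "norm v * (2 * norm w + norm v) \<le> \<epsilon> k * (3 * M)"
    proof (rule mult_mono)
      show "norm v \<le> \<epsilon> k"
        unfolding v_def m_def by (rule e_le)
      moreover have "norm w \<le> M"
        unfolding w_def l_def m_def by (rule w_le[OF aM PM])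
      ultimately show "2 * norm w + norm v \<le> 3 * M"
        using \<epsilon>M[of k] by linarith
    qed (use \<epsilon> in auto)
    also have "(norm w)\<^sup>2 = m * m * (norm (P k - p))\<^sup>2 + l * b k"
      unfolding w_def b_def l_def[symmetric] m_def[symmetric]
      by (simp add: power2_norm_eq_inner inner_commute algebra_simps)
    \<comment> \<open>One factor \<open>m\<close> is given up to match the weight in the recursion;
      firm nonexpansiveness supplies the residual.\<close>
    also have "m * m * (norm (P k - p))\<^sup>2 \<le> m * ((norm (z k - p))\<^sup>2 - (r k)\<^sup>2)"
    proof -
      have "m * m * (norm (P k - p))\<^sup>2 \<le> m * 1 * (norm (P k - p))\<^sup>2"
        using lm by (intro mult_right_mono mult_left_mono) auto
      also have "\<dots> \<le> m * ((norm (z k - p))\<^sup>2 - (r k)\<^sup>2)"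
        using prox_firmly_nonexpansive[OF T c_pos p, of k "z k"] lm
        by (auto simp: P_def r_def intro: mult_left_mono)
      finally show ?thesis .
    qed
    finally show ?thesis
      by (simp add: l_def m_def mult.commute flip: add_divide_distrib)
  qed
  have b_le: "b k \<le> 3 * M\<^sup>2" for k
  proof -
    have "a \<bullet> (P k - p) \<le> M * M"
      using norm_cauchy_schwarz[of a "P k - p"] mult_mono[OF aM PM[of k] M_nonneg] by simp
    then have "2 * ((real k + 1) / (real k + 2)) * (a \<bullet> (P k - p)) \<le> 2 * ((real k + 1) / (real k + 2)) * (M * M)"
      by (intro mult_left_mono) auto
    also have "\<dots> \<le> 2 * 1 * (M * M)"
      by (intro mult_right_mono mult_left_mono) auto
    finally have "2 * ((real k + 1) / (real k + 2)) * (a \<bullet> (P k - p)) \<le> 2 * (M * M)"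
      by simp
    moreover have "(1 / (real k + 2)) * (norm a)\<^sup>2 \<le> 1 * M\<^sup>2"
      using aM by (intro mult_mono power_mono) auto
    ultimately show ?thesis
      by (simp add: b_def power2_eq_square)
  qed
  text \<open>Monotonicity between \<open>y n\<close> and \<open>P k\<close> replaces the usual weak compactness argument.\<close>
  have key: "a \<bullet> (P k - p) \<le> 2 * M * norm (y n - p) + real (Suc n) / \<delta> * (3 * M) * r k" for k n
  proof -
    define t where "t = real (Suc n)"
    have "0 < t" by (simp add: t_def)
    have y_t: "y n = prox_map T t (z 0)"
      by (simp add: y_def t_def)
    have zy: "norm (z 0 - y n) \<le> M"
      using prox_norm_le(2)[OF T \<open>0 < t\<close> p, of "z 0"] aM by (simp add: y_t a_def)
    have yp: "norm (y n - p) \<le> M"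
      using prox_norm_le(1)[OF T \<open>0 < t\<close> p, of "z 0"] aM by (simp add: y_t a_def)
    have Py: "norm (P k - y n) \<le> 3 * M"
      using norm_triangle_ineq4[of "P k - p" "y n - p"] PM[of k] yp M_nonneg by simp
    have "0 \<le> (y n - P k) \<bullet> ((1 / t) *\<^sub>R (z 0 - y n) - (1 / c k) *\<^sub>R (z k - P k))"
      unfolding y_t P_def by (intro maximal_monotone_mono[OF T] prox_graph[OF T] c_pos \<open>0 < t\<close>)
    then have "0 \<le> t * ((y n - P k) \<bullet> ((1 / t) *\<^sub>R (z 0 - y n) - (1 / c k) *\<^sub>R (z k - P k)))"
      using \<open>0 < t\<close> by simp
    also have "\<dots> = (t / c k) * ((P k - y n) \<bullet> (z k - P k)) - (P k - y n) \<bullet> (z 0 - y n)"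
      using \<open>0 < t\<close> by (simp add: inner_simps algebra_simps)
    finally have "(P k - y n) \<bullet> (z 0 - y n) \<le> (t / c k) * ((P k - y n) \<bullet> (z k - P k))"
      by simp
    also have "\<dots> \<le> (t / c k) * ((3 * M) * r k)"
    proof (rule mult_left_mono)
      show "(P k - y n) \<bullet> (z k - P k) \<le> 3 * M * r k"
        using norm_cauchy_schwarz[of "P k - y n" "z k - P k"] mult_right_mono[OF Py, of "r k"]
        by (simp add: r_def)
    qed (use \<open>0 < t\<close> c_pos[of k] in simp)
    \<comment> \<open>Here the parameters being bounded away from zero makes the factor uniform in
      \<open>k\<close>.\<close>
    also have "\<dots> \<le> (t / \<delta>) * ((3 * M) * r k)"
      using \<open>0 < t\<close> c[of k] \<open>0 < \<delta>\<close> M_nonneg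
      by (intro mult_right_mono divide_left_mono) (auto simp: r_def)
    finally have main: "(P k - y n) \<bullet> (z 0 - y n) \<le> t / \<delta> * (3 * M) * r k"
      by (simp add: mult.assoc)
    have "a \<bullet> (P k - p) = (P k - y n) \<bullet> (z 0 - y n) + (z 0 - y n) \<bullet> (y n - p) + (y n - p) \<bullet> (P k - p)"
      by (simp add: a_def inner_simps inner_commute)
    moreover have "(z 0 - y n) \<bullet> (y n - p) \<le> M * norm (y n - p)"
      using norm_cauchy_schwarz[of "z 0 - y n" "y n - p"] mult_right_mono[OF zy, of "norm (y n - p)"]
      by simp
    moreover have "(y n - p) \<bullet> (P k - p) \<le> M * norm (y n - p)"
      using norm_cauchy_schwarz[of "y n - p" "P k - p"] mult_left_mono[OF PM, of "norm (y n - p)" k]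
      by (simp add: mult.commute)
    ultimately show ?thesis
      using main by (simp add: t_def)
  qed
  \<comment> \<open>First \<open>n\<close> is fixed to make the path term of \<open>key\<close> less
    than \<open>e / 8\<close>; only then is the threshold for \<open>r k\<close> chosen, as
    \<open>K\<close> depends on \<open>n\<close>. The inner product is thus below
    \<open>e / 4\<close>, which contributes at most \<open>e / 2\<close> to \<open>b k\<close>, and
    the term with \<open>norm a\<close> adds less than \<open>e / 4\<close>.\<close>
  have small: "\<exists>d>0. \<forall>\<^sub>F k in sequentially. (r k)\<^sup>2 < d \<longrightarrow> b k < e" if "0 < e" for e
  proof -
    have "(\<lambda>n. 2 * M * norm (y n - p)) \<longlonglongrightarrow> 2 * M * norm (p - p)"
      unfolding y_def by (intro tendsto_intros path)
    then have "(\<lambda>n. 2 * M * norm (y n - p)) \<longlonglongrightarrow> 0"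
      by simp
    from order_tendstoD(2)[OF this, of "e / 8"] that
    obtain n where n: "2 * M * norm (y n - p) < e / 8"
      unfolding eventually_sequentially by auto
    \<comment> \<open>The added 1 keeps \<open>K\<close> positive when \<open>M\<close> is
      0.\<close>
    define K where "K = real (Suc n) / \<delta> * (3 * M) + 1"
    have "0 < K"
      using \<open>0 < \<delta>\<close> M_nonneg by (simp add: K_def add_nonneg_pos)
    have "(\<lambda>k. 1 / (real k + 2) * (norm a)\<^sup>2) \<longlonglongrightarrow> 0"
      using tendsto_mult_left_zero[OF LIMSEQ_Suc[OF LIMSEQ_Suc[OF lim_1_over_n]]]
      by (simp add: add.commute)
    from order_tendstoD(2)[OF this, of "e / 4"] that
    have "\<forall>\<^sub>F k in sequentially. 1 / (real k + 2) * (norm a)\<^sup>2 < e / 4"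
      by simp
    then have "\<forall>\<^sub>F k in sequentially. (r k)\<^sup>2 < (e / (8 * K))\<^sup>2 \<longrightarrow> b k < e"
    proof (eventually_elim, intro impI)
      fix k assume k: "1 / (real k + 2) * (norm a)\<^sup>2 < e / 4" and "(r k)\<^sup>2 < (e / (8 * K))\<^sup>2"
      then have "r k < e / (8 * K)"
        using \<open>0 < e\<close> \<open>0 < K\<close> by (simp add: power2_less_imp_less)
      then have "K * r k < e / 8"
        using \<open>0 < K\<close> by (simp add: field_simps)
      moreover have "real (Suc n) / \<delta> * (3 * M) * r k \<le> K * r k"
        by (rule mult_right_mono) (auto simp: K_def r_def)
      ultimately have "a \<bullet> (P k - p) < e / 4"
        using key[of k n] n by linarith
      then have "2 * ((real k + 1) / (real k + 2)) * (a \<bullet> (P k - p)) \<le> 2 * ((real k + 1) / (real k + 2)) * (e / 4)"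
        by (intro mult_left_mono) auto
      also have "\<dots> \<le> 2 * 1 * (e / 4)"
        using \<open>0 < e\<close> by (intro mult_right_mono mult_left_mono) auto
      finally show "b k < e"
        using k \<open>0 < e\<close> unfolding b_def by linarith
    qed
    moreover have "0 < (e / (8 * K))\<^sup>2"
      using \<open>0 < e\<close> \<open>0 < K\<close> by simp
    ultimately show ?thesis by blast
  qed
  have "(\<lambda>k. (norm (z k - p))\<^sup>2) \<longlonglongrightarrow> 0"
    by (rule halpern_recursion_error_tendsto_0[where \<eta> = "\<lambda>k. (r k)\<^sup>2" and b = b and B = "3 * M\<^sup>2"
          and \<epsilon> = "\<lambda>k. 3 * M * \<epsilon> k"])
      (use b_le rec small \<epsilon> M_nonneg in \<open>auto intro: summable_mult\<close>)
  from tendsto_real_sqrt[OF this] have "(\<lambda>k. norm (z k - p)) \<longlonglongrightarrow> 0"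
    by simp
  then show ?thesis
    by (simp add: LIM_zero_iff tendsto_norm_zero_iff)
qed

theorem theorem2p1:
  fixes T :: "'a::{real_inner, complete_space} \<Rightarrow> 'a set"
    and z zbar :: "nat \<Rightarrow> 'a"
    and c \<epsilon> :: "nat \<Rightarrow> real"
  assumes "maximal_monotone T"
    and "op_inverse T 0 \<noteq> {}"
    and "\<And>k. c k > 0"
    and "\<exists>\<delta>>0. \<forall>k. c k \<ge> \<delta>"
    and "halpern_iteration z zbar"
    and "criterion_A T c \<epsilon> z zbar"
  shows "(\<exists>z_inf. limitin weak_topology z z_inf sequentially \<and> 0 \<in> T z_inf)
    \<and> (\<lambda>k. norm (prox_residual T (c k) (z k))) \<longlonglongrightarrow> 0
    \<and> (\<lambda>k. norm (zbar k - z k)) \<longlonglongrightarrow> 0"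
proof -
  obtain q where "0 \<in> T q"
    using assms(2) by (auto simp: op_inverse_def)
  then obtain p where p: "0 \<in> T p" and path: "(\<lambda>n. prox_map T (real (Suc n)) (z 0)) \<longlonglongrightarrow> p"
    using prox_path_converges[OF assms(1)] by metis
  obtain \<delta> where \<delta>: "0 < \<delta>" "\<And>k. \<delta> \<le> c k"
    using assms(4) by blast
  have z: "z \<longlonglongrightarrow> p"
    by (rule halpern_strong_convergence[OF assms(1) \<delta>(2,1) assms(5,6) p path])
  \<comment> \<open>The residual is at most the distance to the zero \<open>p\<close>, which tends
    to 0 by strong convergence.\<close>
  have Q: "(\<lambda>k. norm (prox_residual T (c k) (z k))) \<longlonglongrightarrow> 0"
  proof (rule tendsto_sandwich[OF _ _ tendsto_const])
    show "(\<lambda>k. norm (z k - p)) \<longlonglongrightarrow> 0"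
      using z by (simp add: LIM_zero_iff tendsto_norm_zero_iff)
    show "\<forall>\<^sub>F k in sequentially. norm (prox_residual T (c k) (z k)) \<le> norm (z k - p)"
      unfolding prox_residual_def by (intro always_eventually allI prox_norm_le(2)[OF assms(1,3) p])
  qed simp
  have \<epsilon>: "summable \<epsilon>" and err: "\<And>k. norm (zbar k - prox_map T (c k) (z k)) \<le> \<epsilon> k"
    using assms(6) by (auto simp: criterion_A_def)
  have "(\<lambda>k. norm (zbar k - z k)) \<longlonglongrightarrow> 0"
  proof (rule tendsto_sandwich[OF _ _ tendsto_const])
    show "(\<lambda>k. \<epsilon> k + norm (prox_residual T (c k) (z k))) \<longlonglongrightarrow> 0"
      using tendsto_add[OF summable_LIMSEQ_zero[OF \<epsilon>] Q] by simp
    show "\<forall>\<^sub>F k in sequentially. norm (zbar k - z k) \<le> \<epsilon> k + norm (prox_residual T (c k) (z k))"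
    proof (intro always_eventually allI)
      fix k
      show "norm (zbar k - z k) \<le> \<epsilon> k + norm (prox_residual T (c k) (z k))"
        using norm_triangle_ineq4[of "zbar k - prox_map T (c k) (z k)" "prox_residual T (c k) (z k)"] err[of k]
        by (simp add: prox_residual_def)
    qed
  qed simp
  then show ?thesis
    using limitin_weak_topology[OF z] p Q by blast
qed

end
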